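(* Let $d\ge 1$, let $X^0,X^1,\dots,X^d\subseteq[0,1]^d$ be sets, and let $C\subseteq[0,1]^d$ be a max-min convex set. Assume that $C\cap \operatorname{conv}_{\oplus}(X^i)\neq\emptyset$ for all $0\le i\le d$. Then there exist $x^i\in X^i$, $0\le i\le d$, such that $C\cap\operatorname{conv}_{\oplus}(\{x^0,x^1,\dots,x^d\})\neq\emptyset$.
   Context: For $a,b\in[0,1]$ put $a\oplus b=\max(a,b)$ and $a\otimes b=\min(a,b)$; these act on vectors of $[0,1]^d$ componentwise, with $(\lambda\otimes x)_k=\min(\lambda,x_k)$ for $\lambda\in[0,1]$, $x\in[0,1]^d$. A set $C\subseteq[0,1]^d$ is max-min convex if for all $x,y\in C$ and all $\alpha,\beta\in[0,1]$ with $\alpha\oplus\beta=1$ one has $\alpha\otimes x\oplus\beta\otimes y\in C$. For $X\subseteq[0,1]^d$, the convex hull $\operatorname{conv}_{\oplus}(X)$ is the smallest max-min convex set containing $X$; equivalently, the set of all combinations $\bigoplus_{i=1}^m\lambda_i\otimes x^i$ with $m\ge1$, $x^i\in X$, $\lambda_i\in[0,1]$, $\bigoplus_{i=1}^m\lambda_i=1$. *)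

theory Defs
  imports "HOL-Analysis.Analysis"
begin

definition unit_cube :: "(real ^ 'd) set" where
  "unit_cube = {x. \<forall>k. 0 \<le> x $ k \<and> x $ k \<le> 1}"

definition mm_add :: "real ^ 'd \<Rightarrow> real ^ 'd \<Rightarrow> real ^ 'd" where
  "mm_add x y = (\<chi> k. max (x $ k) (y $ k))"

definition mm_scale :: "real \<Rightarrow> real ^ 'd \<Rightarrow> real ^ 'd" where
  "mm_scale a x = (\<chi> k. min a (x $ k))"

definition mm_convex :: "(real ^ 'd) set \<Rightarrow> bool" where
  "mm_convex C \<longleftrightarrow> C \<subseteq> unit_cube \<and>
     (\<forall>x\<in>C. \<forall>y\<in>C. \<forall>a\<in>{0..1}. \<forall>b\<in>{0..1}.
        max a b = 1 \<longrightarrow> mm_add (mm_scale a x) (mm_scale b y) \<in> C)"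

text \<open>
  The library's \<open>hull\<close> operator intersects all max-min convex sets containing the given set.
  For a subset of the unit cube this family contains the unit cube itself, so that
  the intersection is the smallest max-min convex superset. Outside the unit cube the family
  is empty and \<open>mm_conv\<close> has no meaning.
\<close>

definition mm_conv :: "(real ^ 'd) set \<Rightarrow> (real ^ 'd) set" where
  "mm_conv X = mm_convex hull X"

lemma mm_convex_unit_cube: "mm_convex (unit_cube :: (real ^ 'd) set)"
  by (auto simp: mm_convex_def unit_cube_def mm_add_def mm_scale_def le_max_iff_disj min_le_iff_disj)

lemma mm_convex_mm_conv:
  assumes "X \<subseteq> unit_cube"
  shows "mm_convex (mm_conv X)"
proof -
  have "mm_conv X \<subseteq> unit_cube"
    unfolding mm_conv_def using assms mm_convex_unit_cube by (rule hull_minimal)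
  then show ?thesis
    unfolding mm_convex_def mm_conv_def hull_def by auto
qed

lemma mm_conv_superset: "X \<subseteq> mm_conv X"
  unfolding mm_conv_def by (rule hull_subset)

lemma mm_conv_least: "\<lbrakk>X \<subseteq> D; mm_convex D\<rbrakk> \<Longrightarrow> mm_conv X \<subseteq> D"
  unfolding mm_conv_def by (rule hull_minimal)

end

theory Submission
  imports Defs
begin

text \<open>
  Pick \<open>y\<^sup>i \<in> C \<inter> conv(X\<^sup>i)\<close> and add to each \<open>y\<^sup>i\<close> a zeroth coordinate 1. It suffices to find weights
  \<open>\<mu>\<^sub>i\<close> with maximum 1 such that in \<open>z = \<Oplus>\<^sub>i \<mu>\<^sub>i \<otimes> y\<^sup>i\<close> the \<open>d + 1\<close> coordinates attain their
  maxima at pairwise different indices \<open>i\<close>: if \<open>i\<close> serves coordinate \<open>k\<close>, then a single term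
  \<open>\<lambda> \<otimes> x\<close> of a combination representing \<open>y\<^sup>i\<close> already gives the coordinate \<open>k\<close> of \<open>y\<^sup>i\<close>, and these
  \<open>d + 1\<close> terms together represent \<open>z \<in> C\<close>.

  The weights come from an ascending auction. The coordinates bid for the indices, an index of
  weight \<open>\<mu>\<^sub>i\<close> has value \<open>min(\<mu>\<^sub>i, y\<^sup>i\<^sub>k)\<close> for coordinate \<open>k\<close>, and an unserved coordinate takes an index
  of largest value, whose weight then drops by \<open>\<epsilon>\<close>. An index without bids keeps weight 1, so the
  largest weight is at least \<open>1 - \<epsilon>\<close> when the auction ends. Then let \<open>\<epsilon> \<rightarrow> 0\<close>.
\<close>

section \<open>Weights and a permutation for a square matrix\<close>

lemma approx_tight_permutation:
  fixes a :: "'n::finite \<Rightarrow> 'n \<Rightarrow> real"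
  assumes a: "\<And>i k. 0 \<le> a i k" and e: "0 < e"
  shows "\<exists>\<mu> \<pi>. bij \<pi> \<and> (\<forall>i. 0 \<le> \<mu> i \<and> \<mu> i \<le> 1) \<and> (\<exists>i. 1 - e \<le> \<mu> i) \<and>
    (\<forall>i k. min (\<mu> i) (a i k) \<le> min (\<mu> (\<pi> k)) (a (\<pi> k) k) + e)"
proof -
  \<comment> \<open>\<open>c i\<close> counts the bids for \<open>i\<close>, and \<open>D\<close> is the set of served columns.\<close>
  define v where "v c i k = min (1 - real (c i) * e) (a i k)" for c :: "'n \<Rightarrow> nat" and i k
  \<comment> \<open>The auction's invariant. Unserved indices have no bids, so even the final bid
    leaves some index with at most one; this gives \<open>1 - e\<close>. Bids are made only at
    nonnegative value, so counts stay bounded.\<close>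
  define P where "P = (\<lambda>(c, D, \<pi>). inj_on \<pi> D \<and> (\<forall>i. i \<notin> \<pi> ` D \<longrightarrow> c i = 0) \<and> (\<exists>i. c i \<le> 1) \<and>
    (\<forall>i. real (c i) * e \<le> 1 + e) \<and> (\<forall>k\<in>D. \<forall>i. v c i k \<le> v c (\<pi> k) k + e))"
  define f where "f = (\<lambda>(c :: 'n \<Rightarrow> nat, D :: 'n set, \<pi> :: 'n \<Rightarrow> 'n). \<Sum>i\<in>UNIV. c i)"
  have start: "P (\<lambda>_. 0, {}, id)"
    using e by (simp add: P_def)
  obtain N where N: "(1 + e) / e \<le> real N"
    using real_arch_simple by blast
  have "\<forall>s. P s \<longrightarrow> f s \<le> CARD('n) * N"
  proof (intro allI impI)
    fix s assume "P s"
    have le_N: "c i \<le> N" if "s = (c, D, \<pi>)" for c D \<pi> i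
    proof -
      have "real (c i) * e \<le> 1 + e"
        using \<open>P s\<close> that by (simp add: P_def)
      then have "real (c i) \<le> (1 + e) / e"
        using e by (simp add: field_simps)
      then show ?thesis
        using N by linarith
    qed
    show "f s \<le> CARD('n) * N"
    proof (cases s)
      case (fields c D \<pi>)
      then have "sum c UNIV \<le> of_nat CARD('n) * N"
        using le_N by (intro sum_bounded_above) blast
      then show ?thesis
        by (simp add: f_def fields)
    qed
  qed
  \<comment> \<open>Instead of running the auction, take a state with the most bids; it must be
    final.\<close>
  then obtain s where "P s" and greatest: "\<forall>t. P t \<longrightarrow> f t \<le> f s"
    using ex_has_greatest_nat[of P _ f "Suc (CARD('n) * N)"] start by (metis le_imp_less_Suc)
  obtain c D \<pi> where s: "s = (c, D, \<pi>)"
    by (cases s)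
  have inj: "inj_on \<pi> D" and unserved: "\<And>i. i \<notin> \<pi> ` D \<Longrightarrow> c i = 0" and small: "\<exists>i. c i \<le> 1"
    and bound: "\<And>i. real (c i) * e \<le> 1 + e"
    and near: "\<And>k i. k \<in> D \<Longrightarrow> v c i k \<le> v c (\<pi> k) k + e"
    using \<open>P s\<close> by (auto simp: P_def s)
  have "D = UNIV"
  proof (rule ccontr)
    assume "D \<noteq> UNIV"
    then obtain k where k: "k \<notin> D" by blast
    have "card (\<pi> ` D) < CARD('n)"
      using \<open>D \<noteq> UNIV\<close> by (metis card_image inj finite psubset_card_mono top.not_eq_extremum)
    then obtain j where "j \<notin> \<pi> ` D"
      by (metis UNIV_eq_I less_irrefl)
    then have j: "c j = 0" by (rule unserved)
    obtain i where i: "\<And>l. v c l k \<le> v c i k"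
    proof -
      have "Max (range (\<lambda>l. v c l k)) \<in> range (\<lambda>l. v c l k)"
        by (intro Max_in) auto
      then obtain i where i: "Max (range (\<lambda>l. v c l k)) = v c i k"
        by (rule imageE)
      show thesis
        by (rule that[of i]) (simp flip: i)
    qed
    \<comment> \<open>One more bid: \<open>k\<close> takes the best index \<open>i\<close>, and the
      column that held \<open>i\<close>, if any, becomes unserved.\<close>
    define c' where "c' = c(i := Suc (c i))"
    define D' where "D' = insert k {l \<in> D. \<pi> l \<noteq> i}"
    define \<pi>' where "\<pi>' = \<pi>(k := i)"
    have "0 \<le> v c j k"
      using a by (simp add: v_def j)
    then have "0 \<le> v c i k"
      using i order_trans by blast
    then have ci: "real (c i) * e \<le> 1"
      by (simp add: v_def)
    have v': "v c' l m \<le> v c l m" "v c l m \<le> v c' l m + e" "l \<noteq> i \<Longrightarrow> v c' l m = v c l m" for l m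
      using e by (auto simp: v_def c'_def algebra_simps min_def)
    have "inj_on \<pi>' D'"
      using inj k by (auto simp: inj_on_def D'_def \<pi>'_def)
    moreover have "c' l = 0" if "l \<notin> \<pi>' ` D'" for l
    proof -
      have "l \<noteq> i"
        using that by (auto simp: D'_def \<pi>'_def)
      moreover have "l \<notin> \<pi> ` D"
        using that k \<open>l \<noteq> i\<close> by (force simp: D'_def \<pi>'_def)
      ultimately show ?thesis
        by (simp add: c'_def unserved)
    qed
    moreover have "\<exists>l. c' l \<le> 1"
      using j by (intro exI[of _ j]) (auto simp: c'_def)
    moreover have "real (c' l) * e \<le> 1 + e" for l
      using bound[of l] ci by (simp add: c'_def algebra_simps)
    \<comment> \<open>For \<open>k\<close> the slack \<open>e\<close> absorbs the drop of
      \<open>i\<close>, which was best before; for the other columns only a rival has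
      dropped.\<close>
    moreover have "v c' l m \<le> v c' (\<pi>' m) m + e" if "m \<in> D'" for l m
    proof (cases "m = k")
      case True
      then show ?thesis
        using v'(1)[of l k] v'(2)[of i k] i[of l] by (simp add: \<pi>'_def)
    next
      case False
      then have "m \<in> D" "\<pi> m \<noteq> i"
        using that by (auto simp: D'_def)
      then show ?thesis
        using False v'(1)[of l m] near[of m l] by (simp add: \<pi>'_def v'(3))
    qed
    ultimately have "P (c', D', \<pi>')"
      by (simp add: P_def)
    then have "f (c', D', \<pi>') \<le> f s"
      using greatest by blast
    moreover have "sum c UNIV < sum c' UNIV"
      by (rule sum_strict_mono_ex1) (auto simp: c'_def)
    ultimately show False
      by (simp add: f_def s)
  qed
  \<comment> \<open>\<open>1 - real (c i) * e\<close> can be as low as \<open>- e\<close>. As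
    \<open>a\<close> is nonnegative, clamping it at 0 just clamps the values, which keeps the
    slack.\<close>
  define \<mu> where "\<mu> i = max 0 (1 - real (c i) * e)" for i
  have clamp: "min (\<mu> i) (a i k) = max 0 (v c i k)" for i k
    using a[of i k] by (auto simp: \<mu>_def v_def)
  have "bij \<pi>"
    using inj \<open>D = UNIV\<close> by (simp add: bij_def finite_UNIV_inj_surj)
  moreover have "0 \<le> \<mu> i \<and> \<mu> i \<le> 1" for i
    using e by (simp add: \<mu>_def)
  moreover have "\<exists>i. 1 - e \<le> \<mu> i"
  proof -
    obtain i where "c i \<le> 1" using small by blast
    then have "real (c i) * e \<le> 1 * e"
      using e by (intro mult_right_mono) auto
    then show ?thesis
      by (intro exI[of _ i]) (simp add: \<mu>_def)
  qed
  moreover have "min (\<mu> i) (a i k) \<le> min (\<mu> (\<pi> k)) (a (\<pi> k) k) + e" for i k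
    unfolding clamp using near[of k i] e \<open>D = UNIV\<close> by auto
  ultimately show ?thesis
    by blast
qed

text \<open>The weights lie in a compact cube, and for a fixed permutation and index of large weight
  the conditions are closed, so the slack can tend to 0.\<close>

lemma tight_permutation:
  fixes a :: "'n::finite \<Rightarrow> 'n \<Rightarrow> real"
  assumes a: "\<And>i k. 0 \<le> a i k"
  obtains \<mu> \<pi> where "bij \<pi>" and "\<And>i. \<mu> i \<in> {0..1}" and "\<exists>i. \<mu> i = 1"
    and "\<And>i k. min (\<mu> i) (a i k) \<le> min (\<mu> (\<pi> k)) (a (\<pi> k) k)"
proof -
  define S :: "('n \<Rightarrow> 'n) \<Rightarrow> 'n \<Rightarrow> nat \<Rightarrow> (real ^ 'n) set" where
    "S \<pi> j n = {\<mu> \<in> cbox 0 1. 1 - inverse (Suc n) \<le> \<mu> $ j \<and>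
      (\<forall>i k. min (\<mu> $ i) (a i k) \<le> min (\<mu> $ \<pi> k) (a (\<pi> k) k) + inverse (Suc n))}" for \<pi> j n
  define T where "T n = (\<Union>\<pi> \<in> {\<pi>. bij \<pi>}. \<Union>j. S \<pi> j n)" for n
  have decr: "S \<pi> j n \<subseteq> S \<pi> j m" if "m \<le> n" for \<pi> j m n
  proof -
    have "inverse (real (Suc n)) \<le> inverse (real (Suc m))"
      using that by (intro le_imp_inverse_le) auto
    then show ?thesis
      unfolding S_def by (smt (verit) Collect_mono)
  qed
  have "compact (S \<pi> j n)" for \<pi> j n
  proof -
    have "closed {\<mu> :: real ^ 'n. 1 - inverse (Suc n) \<le> \<mu> $ j \<and>
      (\<forall>i k. min (\<mu> $ i) (a i k) \<le> min (\<mu> $ \<pi> k) (a (\<pi> k) k) + inverse (Suc n))}"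
      by (intro closed_Collect_conj closed_Collect_all closed_Collect_le continuous_intros)
    from compact_Int_closed[OF compact_cbox[of 0 1] this] show ?thesis
      by (simp add: S_def Int_def)
  qed
  then have "compact (T n)" for n
    unfolding T_def by (intro compact_UN) auto
  moreover have "T n \<noteq> {}" for n
  proof -
    obtain \<mu> \<pi> j where "bij \<pi>" "\<forall>i. 0 \<le> \<mu> i \<and> \<mu> i \<le> 1" "1 - inverse (Suc n) \<le> \<mu> j"
      "\<forall>i k. min (\<mu> i) (a i k) \<le> min (\<mu> (\<pi> k)) (a (\<pi> k) k) + inverse (Suc n)"
      using approx_tight_permutation[of a "inverse (Suc n)", OF a]
      by (metis inverse_positive_iff_positive of_nat_0_less_iff zero_less_Suc)
    then have "(\<chi> i. \<mu> i) \<in> S \<pi> j n"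
      by (simp add: S_def mem_box_cart)
    then show ?thesis
      using \<open>bij \<pi>\<close> by (auto simp: T_def)
  qed
  moreover have "T n \<subseteq> T m" if "m \<le> n" for m n
    using decr[OF that] by (fastforce simp: T_def)
  ultimately have "(\<Inter>n. T n) \<noteq> {}"
    by (intro compact_nest) auto
  then obtain \<mu> where \<mu>: "\<And>n. \<mu> \<in> T n" by blast
  \<comment> \<open>There are finitely many pairs: if each failed at some level, all would fail at
    the largest such level, as \<open>S\<close> decreases in \<open>n\<close>.\<close>
  have "\<exists>\<pi> j. bij \<pi> \<and> (\<forall>n. \<mu> \<in> S \<pi> j n)"
  proof (rule ccontr)
    assume "\<not> ?thesis"
    then obtain N where N: "\<And>\<pi> j. bij \<pi> \<Longrightarrow> \<mu> \<notin> S \<pi> j (N \<pi> j)" by metis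
    define M where "M = Max (range (\<lambda>(\<pi>, j). N \<pi> j))"
    have "N \<pi> j \<le> M" for \<pi> j
      unfolding M_def by (intro Max_ge) (auto intro: rev_image_eqI[of "(\<pi>, j)"])
    then have "\<mu> \<notin> T M"
      using N decr unfolding T_def by blast
    then show False using \<mu> by blast
  qed
  then obtain \<pi> j where "bij \<pi>" and S: "\<And>n. \<mu> \<in> S \<pi> j n" by blast
  have lim: "x \<le> y" if "\<And>n. x \<le> y + inverse (Suc n)" for x y :: real
    using that reals_Archimedean[of "x - y"] by (smt (verit))
  have range: "\<mu> $ i \<in> {0..1}" for i
    using S[of 0] by (simp add: S_def mem_box_cart)
  show thesis
  proof (rule that[of \<pi> "\<lambda>i. \<mu> $ i"])
    show "bij \<pi>" by fact
    show "\<mu> $ i \<in> {0..1}" for i by (rule range)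
    have "1 \<le> \<mu> $ j"
      by (rule lim) (use S in \<open>simp add: S_def algebra_simps\<close>)
    then show "\<exists>i. \<mu> $ i = 1"
      using range[of j] by (intro exI[of _ j]) auto
    show "min (\<mu> $ i) (a i k) \<le> min (\<mu> $ \<pi> k) (a (\<pi> k) k)" for i k
      by (rule lim) (use S in \<open>simp add: S_def\<close>)
  qed
qed

section \<open>Terms and combinations in max-min convex sets\<close>

text \<open>Here \<open>None\<close> stands for the zeroth coordinate.\<close>

definition hcoord :: "real ^ 'd \<Rightarrow> 'd option \<Rightarrow> real" where
  "hcoord y k = (case k of None \<Rightarrow> 1 | Some m \<Rightarrow> y $ m)"

lemma hcoord_simps [simp]: "hcoord y None = 1" "hcoord y (Some m) = y $ m"
  by (simp_all add: hcoord_def)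

text \<open>The points of the cube with this property for every \<open>k\<close> form a max-min
  convex set containing \<open>X\<close>.\<close>

lemma mm_conv_tight_term:
  fixes X :: "(real ^ 'd) set"
  assumes X: "X \<subseteq> unit_cube" and y: "y \<in> mm_conv X"
  shows "\<exists>x\<in>X. \<exists>l\<in>{0..1}. (\<forall>m. min l (hcoord x m) \<le> hcoord y m) \<and> min l (hcoord x k) = hcoord y k"
proof -
  define Q where "Q y k \<longleftrightarrow> (\<exists>x\<in>X. \<exists>l\<in>{0..1}. (\<forall>m. min l (hcoord x m) \<le> hcoord y m) \<and>
    min l (hcoord x k) = hcoord y k)" for y k
  have "mm_convex {y \<in> unit_cube. \<forall>k. Q y k}"
    unfolding mm_convex_def
  proof (intro conjI ballI impI)
    fix u w and a b :: real
    assume u: "u \<in> {y \<in> unit_cube. \<forall>k. Q y k}" and w: "w \<in> {y \<in> unit_cube. \<forall>k. Q y k}"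
      and a: "a \<in> {0..1}" and b: "b \<in> {0..1}" and ab: "max a b = 1"
    define z where "z = mm_add (mm_scale a u) (mm_scale b w)"
    \<comment> \<open>At \<open>None\<close> this is the condition
      \<open>max a b = 1\<close>.\<close>
    have z: "hcoord z m = max (min a (hcoord u m)) (min b (hcoord w m))" for m
      using ab a b by (cases m) (auto simp: z_def mm_add_def mm_scale_def)
    \<comment> \<open>A coordinate of \<open>z\<close> comes from one of the two scaled points; the
      term serving that point, capped by its weight \<open>c\<close>, serves
      \<open>z\<close>.\<close>
    have single: "Q z k" if Q: "Q t k" and c: "c \<in> {0..1}" and eq: "hcoord z k = min c (hcoord t k)"
      and le: "\<And>m. min c (hcoord t m) \<le> hcoord z m" for t c k
    proof -
      obtain x l where x: "x \<in> X" "l \<in> {0..1}" "\<And>m. min l (hcoord x m) \<le> hcoord t m"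
        "min l (hcoord x k) = hcoord t k"
        using Q unfolding Q_def by blast
      have "min (min c l) (hcoord x m) \<le> hcoord z m" for m
        using x(3)[of m] le[of m] by linarith
      moreover have "min (min c l) (hcoord x k) = hcoord z k"
        using x(4) eq by (simp add: min.assoc)
      moreover have "min c l \<in> {0..1}"
        using c x(2) by auto
      ultimately show ?thesis
        unfolding Q_def using x(1) by blast
    qed
    have "Q z k" for k
    proof (cases "min a (hcoord u k) \<le> min b (hcoord w k)")
      case True
      then show ?thesis
        using w b by (intro single[of w k b]) (auto simp: z)
    next
      case False
      then show ?thesis
        using u a by (intro single[of u k a]) (auto simp: z)
    qed
    moreover have "z \<in> unit_cube"
      using mm_convex_unit_cube u w a b ab unfolding mm_convex_def z_def by blast
    ultimately show "mm_add (mm_scale a u) (mm_scale b w) \<in> {y \<in> unit_cube. \<forall>k. Q y k}"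
      by (auto simp: z_def)
  qed auto
  moreover have "Q x k" if "x \<in> X" for x k
  proof -
    have "min 1 (hcoord x m) = hcoord x m" for m
      using that X by (cases m) (auto simp: unit_cube_def)
    then show ?thesis
      unfolding Q_def using that by (intro bexI[of _ x] bexI[of _ 1]) auto
  qed
  ultimately have "mm_conv X \<subseteq> {y \<in> unit_cube. \<forall>k. Q y k}"
    using X by (intro mm_conv_least) auto
  then show ?thesis
    using y by (auto simp: Q_def)
qed

text \<open>Induction on the index set, starting from an index of weight 1: the point accumulated so
  far then always enters with weight 1.\<close>

lemma mm_convex_combination:
  fixes x :: "'i::finite \<Rightarrow> real ^ 'd"
  assumes D: "mm_convex D" and x: "\<And>i. x i \<in> D" and l: "\<And>i. l i \<in> {0..1}" and one: "\<exists>i. l i = 1"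
  shows "(\<chi> m. Max (range (\<lambda>i. min (l i) (x i $ m)))) \<in> D"
proof -
  obtain j where j: "l j = 1" using one by blast
  have cube: "0 \<le> y $ m \<and> y $ m \<le> 1" if "y \<in> D" for y m
    using D that by (auto simp: mm_convex_def unit_cube_def)
  have "(\<chi> m. Max ((\<lambda>i. min (l i) (x i $ m)) ` insert j I)) \<in> D" for I
  proof (induction I rule: finite_induct[OF finite])
    case 1
    have "(\<chi> m. min 1 (x j $ m)) = x j"
      using cube[OF x] by (simp add: vec_eq_iff)
    then show ?case
      using x[of j] j by simp
  next
    case (2 i I)
    define z where "z = (\<chi> m. Max ((\<lambda>i. min (l i) (x i $ m)) ` insert j I))"
    have z: "z \<in> D" using 2 by (simp add: z_def)
    have "(\<chi> m. Max ((\<lambda>i. min (l i) (x i $ m)) ` insert j (insert i I)))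
      = mm_add (mm_scale (l i) (x i)) (mm_scale 1 z)"
      using cube[OF z]
      by (simp add: vec_eq_iff mm_add_def mm_scale_def insert_commute[of j i] z_def)
    moreover have "mm_add (mm_scale (l i) (x i)) (mm_scale 1 z) \<in> D"
      using D z x[of i] l[of i] unfolding mm_convex_def by auto
    ultimately show ?case by simp
  qed
  from this[of UNIV] show ?thesis
    by simp
qed

section \<open>Selection of the points\<close>

theorem theorem10:
  fixes X :: "nat \<Rightarrow> (real ^ 'd) set" and C :: "(real ^ 'd) set"
  assumes "\<And>i. i \<le> CARD('d) \<Longrightarrow> X i \<subseteq> unit_cube"
    and "mm_convex C"
    and "\<And>i. i \<le> CARD('d) \<Longrightarrow> C \<inter> mm_conv (X i) \<noteq> {}"
  shows "\<exists>x :: nat \<Rightarrow> real ^ 'd.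
    (\<forall>i \<le> CARD('d). x i \<in> X i) \<and> C \<inter> mm_conv (x ` {..CARD('d)}) \<noteq> {}"
proof -
  \<comment> \<open>Matching the sets with the coordinates, zeroth included, makes the matrix
    square.\<close>
  have "\<exists>h :: 'd option \<Rightarrow> nat. bij_betw h UNIV {..CARD('d)}"
    by (intro finite_same_card_bij) (simp_all add: card_UNIV_option)
  then obtain h :: "'d option \<Rightarrow> nat" where h: "bij_betw h UNIV {..CARD('d)}" by blast
  then have h_le: "h i \<le> CARD('d)" for i
    by (auto simp: bij_betw_def)
  have "\<forall>i. \<exists>y. y \<in> C \<and> y \<in> mm_conv (X (h i))"
    using assms(3)[OF h_le] by blast
  then obtain y where y: "\<And>i. y i \<in> C" "\<And>i. y i \<in> mm_conv (X (h i))"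
    by metis
  have "0 \<le> hcoord (y i) k" for i k
    using y(1)[of i] assms(2) by (cases k) (auto simp: mm_convex_def unit_cube_def)
  then obtain \<mu> \<pi> where "bij \<pi>" and \<mu>: "\<And>i. \<mu> i \<in> {0..1}" "\<exists>i. \<mu> i = 1"
    and tight: "\<And>i k. min (\<mu> i) (hcoord (y i) k) \<le> min (\<mu> (\<pi> k)) (hcoord (y (\<pi> k)) k)"
    by (rule tight_permutation[of "\<lambda>i. hcoord (y i)"]) blast
  have "\<forall>k. \<exists>x l. x \<in> X (h (\<pi> k)) \<and> l \<in> {0..1} \<and>
      (\<forall>m. min l (hcoord x m) \<le> hcoord (y (\<pi> k)) m) \<and> min l (hcoord x k) = hcoord (y (\<pi> k)) k"
    using mm_conv_tight_term[OF assms(1)[OF h_le] y(2)] by blast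
  then obtain x l where x: "\<And>k. x k \<in> X (h (\<pi> k))" and l: "\<And>k. l k \<in> {0..1}"
    and below: "\<And>k m. min (l k) (hcoord (x k) m) \<le> hcoord (y (\<pi> k)) m"
    and attained: "\<And>k. min (l k) (hcoord (x k) k) = hcoord (y (\<pi> k)) k"
    by metis
  define g where "g = h \<circ> \<pi>"
  have g: "bij_betw g UNIV {..CARD('d)}"
    unfolding g_def using \<open>bij \<pi>\<close> h by (rule bij_betw_trans)
  \<comment> \<open>The points were found by coordinate; \<open>inv g\<close> reindexes them by
    set.\<close>
  define x' where "x' = x \<circ> inv g"
  have x': "x' (g k) = x k" for k
    unfolding x'_def comp_apply inv_f_f[OF bij_betw_imp_inj_on[OF g]] ..
  have choice: "x' i \<in> X i" if "i \<le> CARD('d)" for i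
  proof -
    have "i \<in> range g"
      using that g by (simp add: bij_betw_def)
    then obtain k where "i = g k"
      by (rule rangeE)
    then show ?thesis
      using x[of k] unfolding \<open>i = g k\<close> x' by (simp add: g_def)
  qed
  have hull: "mm_convex (mm_conv (range x))"
    using x assms(1)[OF h_le] by (intro mm_convex_mm_conv) blast
  have image: "x' ` {..CARD('d)} = range x"
  proof -
    have "x' ` {..CARD('d)} = x' ` range g"
      using g by (simp add: bij_betw_def)
    also have "\<dots> = range x"
      by (simp only: image_image x')
    finally show ?thesis .
  qed
  define z where "z = (\<chi> m. Max (range (\<lambda>i. min (\<mu> i) (y i $ m))))"
  have "z \<in> C"
    unfolding z_def using assms(2) y(1) \<mu> by (rule mm_convex_combination)
  \<comment> \<open>\<open>tight\<close> and \<open>attained\<close> give one inequality,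
    \<open>below\<close> the other.\<close>
  moreover have "z = (\<chi> m. Max (range (\<lambda>k. min (min (\<mu> (\<pi> k)) (l k)) (x k $ m))))"
    (is "_ = ?w")
  proof (subst vec_eq_iff, intro allI antisym)
    fix m
    have "min (\<mu> i) (y i $ m) \<le> ?w $ m" for i
    proof -
      have "min (\<mu> i) (y i $ m) \<le> min (\<mu> (\<pi> (Some m))) (y (\<pi> (Some m)) $ m)"
        using tight[of i "Some m"] by simp
      also have "\<dots> = min (min (\<mu> (\<pi> (Some m))) (l (Some m))) (x (Some m) $ m)"
        using attained[of "Some m"] by (simp add: min.assoc)
      also have "\<dots> \<le> ?w $ m"
        by (simp only: vec_lambda_beta) (rule Max_ge, auto)
      finally show ?thesis .
    qed
    then show "z $ m \<le> ?w $ m"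
      unfolding z_def by (simp only: vec_lambda_beta) (rule Max.boundedI, auto)
    have "min (min (\<mu> (\<pi> k)) (l k)) (x k $ m) \<le> z $ m" for k
    proof -
      have "min (min (\<mu> (\<pi> k)) (l k)) (x k $ m) \<le> min (\<mu> (\<pi> k)) (y (\<pi> k) $ m)"
        using below[of k "Some m"] by auto
      also have "\<dots> \<le> z $ m"
        unfolding z_def by (simp only: vec_lambda_beta) (rule Max_ge, auto)
      finally show ?thesis .
    qed
    then show "?w $ m \<le> z $ m"
      by (simp only: vec_lambda_beta) (rule Max.boundedI, auto)
  qed
  moreover have "?w \<in> mm_conv (range x)"
  proof (rule mm_convex_combination[OF hull, of x "\<lambda>k. min (\<mu> (\<pi> k)) (l k)"])
    show "x k \<in> mm_conv (range x)" for k
      using mm_conv_superset[of "range x"] by blast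
    show "min (\<mu> (\<pi> k)) (l k) \<in> {0..1}" for k
      using \<mu>(1)[of "\<pi> k"] l[of k] by auto
    \<comment> \<open>The zeroth coordinate supplies the weight 1.\<close>
    obtain i where "\<mu> i = 1" using \<mu>(2) by blast
    then have "\<mu> (\<pi> None) = 1"
      using tight[of i None] \<mu>(1)[of "\<pi> None"] by auto
    moreover have "l None = 1"
      using attained[of None] l[of None] by auto
    ultimately show "\<exists>k. min (\<mu> (\<pi> k)) (l k) = 1"
      by (intro exI[of _ None]) simp
  qed
  ultimately have "C \<inter> mm_conv (x' ` {..CARD('d)}) \<noteq> {}"
    by (auto simp: image)
  then show ?thesis
    using choice by blast
qed

end
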